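(* Let $\alpha\in(\frac14,\frac13]$ (so $N=\lfloor1/\alpha\rfloor=3$), let $\mathbf X$ be an $\alpha$-Hölder planarly branched rough path over $A=\{1,\dots,d\}$ above $X=(X^1,\dots,X^d):[0,T]\to\mathbb R^d$, and let $F:\mathbb R^d\to\mathbb R^n$ be a smooth function. Define $\mathbf Z:[0,T]\to(\mathbb R\mathcal F^{\le2})^n$ by $$\langle\mathbf 1,\mathbf Z_t\rangle:=F(X_t),\quad\langle\bullet_i,\mathbf Z_t\rangle:=\partial_iF(X_t),\quad\langle\bullet_i\bullet_j,\mathbf Z_t\rangle:=\partial_i\partial_jF(X_t),\quad\langle[\bullet_j]_i,\mathbf Z_t\rangle:=0,\qquad i,j\in A.$$ Then $\mathbf Z$ is an $\mathbf X$-controlled planarly branched rough path above $F(X)$.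
   Context: Forests. $\mathcal F$ is the set of $A$-decorated planar rooted forests, i.e. finite ordered (possibly empty) sequences of planar rooted trees with vertices decorated by $A=\{1,\dots,d\}$; concatenation is written as juxtaposition, $\mathbf 1$ is the empty forest, $|\tau|$ is the number of vertices, and $\mathcal F^{\le m}=\{\tau\in\mathcal F:|\tau|\le m\}$. For $\tau\in\mathcal F$ and $i\in A$, $[\tau]_i$ is the tree obtained by joining the roots of the trees of $\tau$ (in the same left-to-right order) to a new root decorated by $i$; $\bullet_i=[\mathbf 1]_i$. Thus $[\bullet_j]_i$ is the ladder with root $i$ and leaf $j$. Munthe-Kaas–Wright (MKW) Hopf algebra: $\mathbb R\mathcal F$ with the shuffle product ⧢ (forests viewed as words whose letters are trees) and the coproduct $\Delta$ given recursively by $\Delta(\mathbf 1)=\mathbf 1\otimes\mathbf 1$ and $\Delta(\omega[\tau]_i)=\omega[\tau]_i\otimes\mathbf 1+\Delta(\omega)\cdot(\mathrm{id}\otimes[\,\cdot\,]_i)\Delta(\tau)$ for $\omega,\tau\in\mathcal F$, where $\cdot$ shuffles left tensor factors and concatenates right tensor factors (left admissible cuts). The pairing is $\langle\tau,\tau'\rangle=\delta_{\tau,\tau'}$ on forests and $\star$ is the dual product: $\langle x\star y,\tau\rangle=\langle x\otimes y,\Delta\tau\rangle$. Everything is truncated at $\mathbb R\mathcal F^{\le N}$. Planarly branched rough path. Let $\alpha\in(0,1]$, $N=\lfloor1/\alpha\rfloor$. An $\alpha$-Hölder planarly branched rough path is a map $\mathbf X:[0,T]^2\to\mathbb R\mathcal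 F^{\le N}$ with $\langle\mathbf X_{s,t},\mathbf 1\rangle=1$ such that (1) $\mathbf X_{s,u}\star\mathbf X_{u,t}=\mathbf X_{s,t}$ in the algebra truncated at $N$; (2) $\langle\mathbf X_{s,t},\sigma ⧢ \tau\rangle=\langle\mathbf X_{s,t},\sigma\rangle\langle\mathbf X_{s,t},\tau\rangle$ whenever $|\sigma|+|\tau|\le N$; (3) $\sup_{s\ne t}|\langle\mathbf X_{s,t},\tau\rangle|/|t-s|^{|\tau|\alpha}<\infty$ for all $\tau\in\mathcal F^{\le N}$. It is above $X=(X^1,\dots,X^d)$ if $\langle\mathbf X_{s,t},\bullet_i\rangle=X^i_t-X^i_s$ for all $i$. Controlled path. A map $\mathbf Y:[0,T]\to(\mathbb R\mathcal F^{\le N-1})^n$ (so $\langle\tau,\mathbf Y_t\rangle\in\mathbb R^n$) is an $\mathbf X$-controlled planarly branched rough path above $Y=\langle\mathbf 1,\mathbf Y\rangle$ if $|\langle\tau,\mathbf Y_t\rangle-\langle\mathbf X_{s,t}\star\tau,\mathbf Y_s\rangle|=O(|t-s|^{(N-|\tau|)\alpha})$ uniformly in $s,t$, for all $\tau\in\mathcal F^{\le N-1}$. *)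

theory Defs
  imports "HOL-Analysis.Analysis" "HOL-Library.Poly_Mapping"
begin

section \<open>Decorated planar forests\<close>

datatype 'a ptree = Node 'a "'a ptree list"

type_synonym 'a forest = "'a ptree list"

fun tree_vertices :: "'a ptree \<Rightarrow> nat" where
  "tree_vertices (Node i \<tau>) = Suc (sum_list (map tree_vertices \<tau>))"

definition vertices :: "'a forest \<Rightarrow> nat" where
  "vertices \<tau> = sum_list (map tree_vertices \<tau>)"

lemma vertices_simps [simp]:
  "vertices [] = 0"
  "vertices (t # \<tau>) = tree_vertices t + vertices \<tau>"
  "vertices (\<sigma> @ \<tau>) = vertices \<sigma> + vertices \<tau>"
  by (simp_all add: vertices_def)

lemma tree_vertices_Node [simp]: "tree_vertices (Node i \<tau>) = Suc (vertices \<tau>)"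
  by (simp add: vertices_def)

declare tree_vertices.simps [simp del]

definition forests_le :: "nat \<Rightarrow> 'a forest set" where
  "forests_le m = {\<tau>. vertices \<tau> \<le> m}"

abbreviation bullet :: "'a \<Rightarrow> 'a ptree" where
  "bullet i \<equiv> Node i []"

lemma finite_forests_le: "finite (forests_le m :: 'a::finite forest set)"
proof (induction m)
  case 0
  have "\<tau> = []" if "vertices \<tau> = 0" for \<tau> :: "'a forest"
  proof (cases \<tau>)
    case (Cons t \<sigma>)
    then show ?thesis using that by (cases t) simp
  qed simp
  then have "(forests_le 0 :: 'a forest set) \<subseteq> {[]}"
    by (auto simp: forests_le_def)
  then show ?case by (rule finite_subset) simp
next
  case (Suc m)
  let ?f = "\<lambda>(i, \<sigma>, \<tau>). Node (i :: 'a) \<sigma> # \<tau>"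
  have "forests_le (Suc m) \<subseteq> {[]} \<union> ?f ` (UNIV \<times> forests_le m \<times> forests_le m)"
  proof
    fix \<rho> :: "'a forest"
    assume \<rho>: "\<rho> \<in> forests_le (Suc m)"
    show "\<rho> \<in> {[]} \<union> ?f ` (UNIV \<times> forests_le m \<times> forests_le m)"
    proof (cases \<rho>)
      case (Cons t \<tau>)
      obtain i \<sigma> where t: "t = Node i \<sigma>" by (cases t)
      from \<rho> Cons t have "\<rho> = ?f (i, \<sigma>, \<tau>)"
        "(i, \<sigma>, \<tau>) \<in> UNIV \<times> forests_le m \<times> forests_le m"
        by (auto simp: forests_le_def)
      then show ?thesis by blast
    qed simp
  qed
  then show ?case
    using Suc.IH by (elim finite_subset) simp
qed


section \<open>The Munthe-Kaas--Wright Hopf algebra\<close>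

text \<open>The free real vector space on a type \<open>'k\<close> is \<open>'k \<Rightarrow>\<^sub>0 real\<close>; its tensor square is
  \<open>'k \<times> 'k \<Rightarrow>\<^sub>0 real\<close>.\<close>

definition basis :: "'k \<Rightarrow> 'k \<Rightarrow>\<^sub>0 real" where
  "basis k = Poly_Mapping.single k 1"

definition scale :: "real \<Rightarrow> ('k \<Rightarrow>\<^sub>0 real) \<Rightarrow> 'k \<Rightarrow>\<^sub>0 real" where
  "scale c x = Poly_Mapping.map ((*) c) x"

definition lin_ext :: "('k \<Rightarrow> 'l \<Rightarrow>\<^sub>0 real) \<Rightarrow> ('k \<Rightarrow>\<^sub>0 real) \<Rightarrow> 'l \<Rightarrow>\<^sub>0 real" where
  "lin_ext f x = (\<Sum>k\<in>Poly_Mapping.keys x. scale (Poly_Mapping.lookup x k) (f k))"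

definition tensor :: "('k \<Rightarrow>\<^sub>0 real) \<Rightarrow> ('l \<Rightarrow>\<^sub>0 real) \<Rightarrow> ('k \<times> 'l) \<Rightarrow>\<^sub>0 real" where
  "tensor x y = lin_ext (\<lambda>k. lin_ext (\<lambda>l. basis (k, l)) y) x"

definition pairing :: "('k \<Rightarrow>\<^sub>0 real) \<Rightarrow> ('k \<Rightarrow>\<^sub>0 real) \<Rightarrow> real" where
  "pairing x y = (\<Sum>k\<in>Poly_Mapping.keys x. Poly_Mapping.lookup x k * Poly_Mapping.lookup y k)"

definition pairing_vec :: "('k \<Rightarrow>\<^sub>0 real) \<Rightarrow> ('k \<Rightarrow>\<^sub>0 real) ^ 'n \<Rightarrow> real ^ 'n" where
  "pairing_vec x Y = (\<chi> k. pairing x (Y $ k))"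

text \<open>The shuffle product of two words, counted with multiplicity
  (unlike \<^const>\<open>shuffles\<close>, which is a set).\<close>

fun shuffle :: "'b list \<Rightarrow> 'b list \<Rightarrow> 'b list \<Rightarrow>\<^sub>0 real" where
  "shuffle [] ys = basis ys"
| "shuffle xs [] = basis xs"
| "shuffle (x # xs) (y # ys) =
     lin_ext (\<lambda>w. basis (x # w)) (shuffle xs (y # ys)) +
     lin_ext (\<lambda>w. basis (y # w)) (shuffle (x # xs) ys)"

text \<open>\<open>(a \<otimes> b) \<cdot> (c \<otimes> d) = (a shuffled with c) \<otimes> bd\<close>, extended bilinearly.\<close>

definition shuffle_concat ::
  "('b list \<times> 'b list \<Rightarrow>\<^sub>0 real) \<Rightarrow> ('b list \<times> 'b list \<Rightarrow>\<^sub>0 real) \<Rightarrow> 'b list \<times> 'b list \<Rightarrow>\<^sub>0 real" where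
  "shuffle_concat p q =
     lin_ext (\<lambda>(a, b). lin_ext (\<lambda>(c, d). tensor (shuffle a c) (basis (b @ d))) q) p"

function coproduct :: "'a forest \<Rightarrow> 'a forest \<times> 'a forest \<Rightarrow>\<^sub>0 real" where
  "coproduct [] = basis ([], [])"
| "coproduct (\<omega> @ [Node i \<tau>]) =
     basis (\<omega> @ [Node i \<tau>], []) +
     shuffle_concat (coproduct \<omega>) (lin_ext (\<lambda>(a, b). basis (a, [Node i b])) (coproduct \<tau>))"
  by (metis ptree.exhaust rev_exhaust) auto
termination
  by (relation "Wellfounded.measure vertices") auto

text \<open>The dual product, truncated at level \<open>N\<close>. The index set of the sum is finite by
  \<open>finite_forests_le\<close>, because the decorations form a finite type.\<close>

definition star :: "nat \<Rightarrow> ('a::finite forest \<Rightarrow>\<^sub>0 real) \<Rightarrow> ('a forest \<Rightarrow>\<^sub>0 real) \<Rightarrow> 'a forest \<Rightarrow>\<^sub>0 real" where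
  "star N x y = (\<Sum>\<tau>\<in>forests_le N. scale (pairing (tensor x y) (coproduct \<tau>)) (basis \<tau>))"


section \<open>Planarly branched rough paths and controlled paths\<close>

definition level :: "real \<Rightarrow> nat" where
  "level \<alpha> = nat \<lfloor>1 / \<alpha>\<rfloor>"

definition planarly_branched_rough_path ::
  "real \<Rightarrow> real \<Rightarrow> (real \<Rightarrow> real \<Rightarrow> 'a::finite forest \<Rightarrow>\<^sub>0 real) \<Rightarrow> bool" where
  "planarly_branched_rough_path \<alpha> T \<XX> \<longleftrightarrow>
     0 < \<alpha> \<and> \<alpha> \<le> 1 \<and>
     (\<forall>s\<in>{0..T}. \<forall>t\<in>{0..T}. Poly_Mapping.keys (\<XX> s t) \<subseteq> forests_le (level \<alpha>)) \<and>
     (\<forall>s\<in>{0..T}. \<forall>t\<in>{0..T}. pairing (\<XX> s t) (basis []) = 1) \<and>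
     (\<forall>s\<in>{0..T}. \<forall>u\<in>{0..T}. \<forall>t\<in>{0..T}. star (level \<alpha>) (\<XX> s u) (\<XX> u t) = \<XX> s t) \<and>
     (\<forall>s\<in>{0..T}. \<forall>t\<in>{0..T}. \<forall>\<sigma> \<tau>. vertices \<sigma> + vertices \<tau> \<le> level \<alpha> \<longrightarrow>
        pairing (\<XX> s t) (shuffle \<sigma> \<tau>) =
        pairing (\<XX> s t) (basis \<sigma>) * pairing (\<XX> s t) (basis \<tau>)) \<and>
     (\<forall>\<tau>\<in>forests_le (level \<alpha>).
        bdd_above {\<bar>pairing (\<XX> s t) (basis \<tau>)\<bar> / \<bar>t - s\<bar> powr (real (vertices \<tau>) * \<alpha>) | s t.
          s \<in> {0..T} \<and> t \<in> {0..T} \<and> s \<noteq> t})"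

definition rough_path_above ::
  "real \<Rightarrow> (real \<Rightarrow> real \<Rightarrow> 'a::finite forest \<Rightarrow>\<^sub>0 real) \<Rightarrow> (real \<Rightarrow> real ^ 'a) \<Rightarrow> bool" where
  "rough_path_above T \<XX> X \<longleftrightarrow>
     (\<forall>s\<in>{0..T}. \<forall>t\<in>{0..T}. \<forall>i. pairing (\<XX> s t) (basis [bullet i]) = X t $ i - X s $ i)"

text \<open>\<open>(\<real>\<F>)\<^sup>n\<close> is \<open>('a forest \<Rightarrow>\<^sub>0 real) ^ 'n\<close>. On \<open>s = t\<close> the bound below reads \<open>0\<close>,
  since \<open>0 powr x = 0\<close> and the exponent is positive.\<close>

definition controlled_path ::
  "real \<Rightarrow> real \<Rightarrow> (real \<Rightarrow> real \<Rightarrow> 'a::finite forest \<Rightarrow>\<^sub>0 real) \<Rightarrow>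
   (real \<Rightarrow> ('a forest \<Rightarrow>\<^sub>0 real) ^ 'n) \<Rightarrow> bool" where
  "controlled_path \<alpha> T \<XX> Y \<longleftrightarrow>
     (\<forall>t\<in>{0..T}. \<forall>k. Poly_Mapping.keys (Y t $ k) \<subseteq> forests_le (level \<alpha> - 1)) \<and>
     (\<forall>\<tau>\<in>forests_le (level \<alpha> - 1). \<exists>C. \<forall>s\<in>{0..T}. \<forall>t\<in>{0..T}.
        norm (pairing_vec (basis \<tau>) (Y t) - pairing_vec (star (level \<alpha>) (\<XX> s t) (basis \<tau>)) (Y s))
        \<le> C * \<bar>t - s\<bar> powr (real (level \<alpha> - vertices \<tau>) * \<alpha>))"

definition controlled_path_above ::
  "real \<Rightarrow> (real \<Rightarrow> ('a forest \<Rightarrow>\<^sub>0 real) ^ 'n) \<Rightarrow> (real \<Rightarrow> real ^ 'n) \<Rightarrow> bool" where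
  "controlled_path_above T Y y \<longleftrightarrow> (\<forall>t\<in>{0..T}. pairing_vec (basis []) (Y t) = y t)"


section \<open>Partial derivatives and smoothness\<close>

definition partial_deriv ::
  "'d::finite \<Rightarrow> (real ^ 'd \<Rightarrow> 'b::real_normed_vector) \<Rightarrow> real ^ 'd \<Rightarrow> 'b" where
  "partial_deriv i F x = vector_derivative (\<lambda>h. F (x + h *\<^sub>R axis i 1)) (at 0)"

fun C_k :: "nat \<Rightarrow> (real ^ 'd::finite \<Rightarrow> 'b::real_normed_vector) \<Rightarrow> bool" where
  "C_k 0 F \<longleftrightarrow> continuous_on UNIV F"
| "C_k (Suc k) F \<longleftrightarrow> (\<forall>x. F differentiable (at x)) \<and> (\<forall>i. C_k k (partial_deriv i F))"

definition smooth :: "(real ^ 'd::finite \<Rightarrow> 'b::real_normed_vector) \<Rightarrow> bool" where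
  "smooth F \<longleftrightarrow> (\<forall>k. C_k k F)"

end

theory Submission
  imports Defs
begin

text \<open>Write \<open>v = X\<^sub>t - X\<^sub>s\<close>. Only forests with at most two vertices pair with \<open>Z\<^sub>s\<close>, so
  \<open>\<langle>\<XX>\<^sub>s\<^sub>,\<^sub>t \<star> \<tau>, Z\<^sub>s\<rangle>\<close> can be read off from the coproducts of these forests. For \<open>\<tau> = \<bullet>\<^sub>i\<close> it is the
  first-order, for \<open>|\<tau>| = 2\<close> the zeroth-order Taylor polynomial of the corresponding
  derivative of \<open>F\<close> (and \<open>0\<close> for ladders). For \<open>\<tau> = \<one>\<close> the quadratic term is
  \<open>\<Sum>\<langle>\<XX>\<^sub>s\<^sub>,\<^sub>t, \<bullet>\<^sub>i\<bullet>\<^sub>j\<rangle> \<partial>\<^sub>i\<partial>\<^sub>jF(X\<^sub>s)\<close>; because mixed partial derivatives commute, only the symmetric part of the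
  coefficients matters, and the shuffle relation \<open>\<bullet>\<^sub>i \<squnion> \<bullet>\<^sub>j = \<bullet>\<^sub>i\<bullet>\<^sub>j + \<bullet>\<^sub>j\<bullet>\<^sub>i\<close> identifies that part as
  \<open>v\<^sub>i v\<^sub>j / 2\<close>. The errors are thus Taylor remainders, of order \<open>|v|\<close> to the power \<open>3 - |\<tau>|\<close>, hence
  \<open>O(|t - s|^((3 - |\<tau>|)\<alpha>))\<close>.\<close>

section \<open>Coproducts of small forests\<close>

lemma lookup_scale [simp]: "Poly_Mapping.lookup (scale c x) k = c * Poly_Mapping.lookup x k"
  by (simp add: scale_def Poly_Mapping.map.rep_eq when_def)

lemma lookup_basis: "Poly_Mapping.lookup (basis k) l = (if k = l then 1 else 0)"
  by (simp add: basis_def lookup_single when_def)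

lemma keys_basis [simp]: "Poly_Mapping.keys (basis k) = {k}"
  by (simp add: basis_def)

text \<open>Indices outside the support contribute coefficient 0. Additivity follows by summing both
  arguments over the union of their supports.\<close>

lemma lin_ext_superset:
  assumes "finite S" "Poly_Mapping.keys x \<subseteq> S"
  shows "lin_ext f x = (\<Sum>k\<in>S. scale (Poly_Mapping.lookup x k) (f k))"
  unfolding lin_ext_def
  using assms by (intro sum.mono_neutral_left) (auto simp: in_keys_iff intro!: poly_mapping_eqI)

lemma lin_ext_add [simp]: "lin_ext f (x + y) = lin_ext f x + lin_ext f y"
proof -
  let ?S = "Poly_Mapping.keys x \<union> Poly_Mapping.keys y"
  have "Poly_Mapping.keys (x + y) \<subseteq> ?S"
    by (rule keys_add)
  then show ?thesis
    by (simp add: lin_ext_superset[of ?S] sum.distrib[symmetric] del: sum.distrib)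
       (intro sum.cong refl poly_mapping_eqI, simp add: lookup_add algebra_simps)
qed

lemma lin_ext_basis [simp]: "lin_ext f (basis k) = f k"
  by (auto simp: lin_ext_def lookup_basis intro: poly_mapping_eqI)

lemma tensor_basis [simp]: "tensor (basis k) (basis l) = basis (k, l)"
  by (simp add: tensor_def)

text \<open>Pairing \<open>tensor x (basis l)\<close> with a coproduct thus keeps only the cuts
  whose right factor is \<open>l\<close> and reads off \<open>x\<close> at the left factor.\<close>

lemma lookup_tensor_basis:
  "Poly_Mapping.lookup (tensor x (basis l)) (a, b) = (if b = l then Poly_Mapping.lookup x a else 0)"
  by (auto simp: tensor_def lin_ext_def[of _ x] lookup_sum lookup_basis in_keys_iff
      if_distrib[where f = "(*) _"] cong: if_cong)

lemma pairing_superset: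
  assumes "finite S" "Poly_Mapping.keys x \<subseteq> S"
  shows "pairing x y = (\<Sum>k\<in>S. Poly_Mapping.lookup x k * Poly_Mapping.lookup y k)"
  unfolding pairing_def
  using assms by (intro sum.mono_neutral_left) (auto simp: in_keys_iff)

lemma pairing_add_right [simp]: "pairing x (y + z) = pairing x y + pairing x z"
  by (simp add: pairing_def lookup_add algebra_simps sum.distrib)

lemma pairing_basis_right [simp]: "pairing x (basis k) = Poly_Mapping.lookup x k"
  by (simp add: pairing_def lookup_basis in_keys_iff if_distrib[where f = "(*) _"] cong: if_cong)

lemma pairing_basis_left [simp]: "pairing (basis k) y = Poly_Mapping.lookup y k"
  by (simp add: pairing_def lookup_basis)

section \<open>Left admissible cuts of forests with at most two vertices\<close>

lemma coproduct_bullet: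
  "coproduct [bullet i] = basis ([bullet i], []) + basis ([], [bullet i])"
  using coproduct.simps(2)[of "[]" i "[]"] by (simp add: shuffle_concat_def)

text \<open>Only the left tree can be cut off alone: right factors are concatenated and the last
  tree is grafted there, so no term has \<open>[bullet j]\<close> on the left and
  \<open>[bullet i]\<close> on the right.\<close>

lemma coproduct_bullet_bullet:
  "coproduct [bullet i, bullet j] =
     basis ([bullet i, bullet j], []) + (basis ([bullet i], [bullet j]) + basis ([], [bullet i, bullet j]))"
  using coproduct.simps(2)[of "[bullet i]" j "[]"]
  by (simp add: shuffle_concat_def coproduct_bullet)

lemma coproduct_ladder:
  "coproduct [Node i [bullet j]] =
     basis ([Node i [bullet j]], []) + (basis ([bullet j], [bullet i]) + basis ([], [Node i [bullet j]]))"
  using coproduct.simps(2)[of "[]" i "[bullet j]"]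
  by (simp add: shuffle_concat_def coproduct_bullet)

lemma vertices_eq_0_iff [simp]: "vertices \<tau> = 0 \<longleftrightarrow> \<tau> = []"
proof (cases \<tau>)
  case (Cons t \<sigma>)
  then show ?thesis by (cases t) simp
qed simp

lemma vertices_eq_1_iff: "vertices \<tau> = Suc 0 \<longleftrightarrow> (\<exists>i. \<tau> = [bullet i])"
proof (cases \<tau>)
  case (Cons t \<sigma>)
  then show ?thesis by (cases t) auto
qed simp

text \<open>Removing the root of the first tree leaves at most one vertex, which lies either among
  its children \<open>\<rho>\<close> or in the remaining trees \<open>\<sigma>\<close>.\<close>

lemma vertices_le_2_cases:
  assumes "vertices \<tau> \<le> 2"
  obtains "\<tau> = []" | i where "\<tau> = [bullet i]" | i j where "\<tau> = [bullet i, bullet j]"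
    | i j where "\<tau> = [Node i [bullet j]]"
proof (cases \<tau>)
  case Nil
  then show ?thesis using that by blast
next
  case (Cons t \<sigma>)
  obtain i \<rho> where t: "t = Node i \<rho>" by (cases t)
  have "vertices \<rho> + vertices \<sigma> \<le> Suc 0"
    using assms Cons t by simp
  then consider "vertices \<rho> = 0" "vertices \<sigma> = 0" | "vertices \<rho> = 0" "vertices \<sigma> = Suc 0"
    | "vertices \<rho> = Suc 0" "vertices \<sigma> = 0"
    by linarith
  then show ?thesis
    by cases (use that Cons t in \<open>auto simp: vertices_eq_1_iff\<close>)
qed

text \<open>The four shapes are disjoint, and each is parametrised injectively by its decorations.
  The codomain is general because the sums below are vector valued.\<close>

lemma sum_forests_le_2:
  fixes f :: "'a::finite forest \<Rightarrow> 'b::comm_monoid_add"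
  shows "(\<Sum>\<tau>\<in>forests_le 2. f \<tau>) = f [] + (\<Sum>i\<in>UNIV. f [bullet i]) +
    (\<Sum>i\<in>UNIV. \<Sum>j\<in>UNIV. f [bullet i, bullet j]) + (\<Sum>i\<in>UNIV. \<Sum>j\<in>UNIV. f [Node i [bullet j]])"
proof -
  let ?A = "{[]} :: 'a forest set"
  let ?B = "(\<lambda>i. [bullet i]) ` (UNIV :: 'a set)"
  let ?C = "(\<lambda>(i, j). [bullet i, bullet j]) ` (UNIV :: ('a \<times> 'a) set)"
  let ?D = "(\<lambda>(i, j). [Node i [bullet j]]) ` (UNIV :: ('a \<times> 'a) set)"
  have "forests_le 2 = ((?A \<union> ?B) \<union> ?C) \<union> ?D"
    by (auto simp: forests_le_def elim!: vertices_le_2_cases)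
  then have "(\<Sum>\<tau>\<in>forests_le 2. f \<tau>) = sum f (((?A \<union> ?B) \<union> ?C) \<union> ?D)"
    by simp
  also have "\<dots> = sum f ?A + sum f ?B + sum f ?C + sum f ?D"
    by (subst sum.union_disjoint; (subst sum.union_disjoint; (subst sum.union_disjoint)?)?) auto
  also have "sum f ?B = (\<Sum>i\<in>UNIV. f [bullet i])"
    by (subst sum.reindex) (auto simp: inj_on_def)
  also have "sum f ?C = (\<Sum>i\<in>UNIV. \<Sum>j\<in>UNIV. f [bullet i, bullet j])"
    by (subst sum.reindex) (auto simp: inj_on_def sum.cartesian_product intro!: sum.cong)
  also have "sum f ?D = (\<Sum>i\<in>UNIV. \<Sum>j\<in>UNIV. f [Node i [bullet j]])"
    by (subst sum.reindex) (auto simp: inj_on_def sum.cartesian_product intro!: sum.cong)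
  finally show ?thesis by simp
qed

text \<open>Duality of \<open>star\<close> and \<open>coproduct\<close>: since \<open>Y\<close>
  lives on levels up to \<open>M\<close> and \<open>M \<le> N\<close>, truncating the product at
  \<open>N\<close> does not affect the pairing.\<close>

lemma pairing_vec_star:
  fixes x :: "'a::finite forest \<Rightarrow>\<^sub>0 real" and Y :: "('a forest \<Rightarrow>\<^sub>0 real) ^ 'n"
  assumes "M \<le> N" and keys: "\<And>k. Poly_Mapping.keys (Y $ k) \<subseteq> forests_le M"
  shows "pairing_vec (star N x y) Y =
    (\<Sum>\<sigma>\<in>forests_le M. pairing (tensor x y) (coproduct \<sigma>) *\<^sub>R pairing_vec (basis \<sigma>) Y)"
proof -
  let ?c = "\<lambda>\<sigma>. pairing (tensor x y) (coproduct \<sigma>)"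
  have lookup: "Poly_Mapping.lookup (star N x y) \<sigma> = (if \<sigma> \<in> forests_le N then ?c \<sigma> else 0)" for \<sigma>
    by (simp add: star_def lookup_sum lookup_basis if_distrib[where f="(*) _"] finite_forests_le cong: if_cong)
  have "pairing (star N x y) (Y $ k) = (\<Sum>\<sigma>\<in>forests_le M. ?c \<sigma> * Poly_Mapping.lookup (Y $ k) \<sigma>)" for k
  proof -
    have "pairing (star N x y) (Y $ k) = (\<Sum>\<sigma>\<in>forests_le N. ?c \<sigma> * Poly_Mapping.lookup (Y $ k) \<sigma>)"
      by (subst pairing_superset[of "forests_le N"])
        (auto simp: finite_forests_le in_keys_iff lookup split: if_splits)
    also have "\<dots> = (\<Sum>\<sigma>\<in>forests_le M. ?c \<sigma> * Poly_Mapping.lookup (Y $ k) \<sigma>)"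
      using keys[of k] assms(1)
      by (intro sum.mono_neutral_right finite_forests_le) (auto simp: forests_le_def in_keys_iff)
    finally show ?thesis .
  qed
  then show ?thesis
    by (simp add: vec_eq_iff pairing_vec_def)
qed

text \<open>Shuffling two one-letter words yields both orders; for \<open>i = j\<close> the word is
  counted twice, so the formula holds there as well.\<close>

lemma pairing_shuffle_bullets:
  "pairing x (shuffle [bullet i] [bullet j]) =
     Poly_Mapping.lookup x [bullet i, bullet j] + Poly_Mapping.lookup x [bullet j, bullet i]"
  by simp

section \<open>Taylor expansion with partial derivatives\<close>

lemma has_derivative_line:
  "((\<lambda>h. x + h *\<^sub>R v) has_derivative (\<lambda>r. r *\<^sub>R v)) (at h)"
  using has_derivative_add[OF has_derivative_const[of x] has_derivative_scaleR_left[OF has_derivative_ident, of v]]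
  by simp

text \<open>The chain rule along a coordinate line identifies each partial derivative with the
  Frechet derivative at a unit vector; linearity does the rest.\<close>

lemma has_derivative_partial_deriv:
  fixes F :: "real ^ 'd::finite \<Rightarrow> 'b::real_normed_vector"
  assumes "F differentiable (at x)"
  shows "(F has_derivative (\<lambda>v. \<Sum>i\<in>UNIV. v $ i *\<^sub>R partial_deriv i F x)) (at x)"
proof -
  obtain D where D: "(F has_derivative D) (at x)"
    using assms by (auto simp: differentiable_def)
  then interpret bounded_linear D
    by (rule has_derivative_bounded_linear)
  have partial: "partial_deriv i F x = D (axis i 1)" for i
  proof -
    have "((\<lambda>h. F (x + h *\<^sub>R axis i 1)) has_derivative (\<lambda>h. D (h *\<^sub>R axis i 1))) (at 0)"
      using D by (intro has_derivative_compose[OF has_derivative_line, where g = F]) simp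
    then have "((\<lambda>h. F (x + h *\<^sub>R axis i 1)) has_vector_derivative D (axis i 1)) (at 0)"
      by (simp add: has_vector_derivative_def scaleR)
    then show ?thesis
      unfolding partial_deriv_def by (rule vector_derivative_at)
  qed
  have "D v = (\<Sum>i\<in>UNIV. v $ i *\<^sub>R partial_deriv i F x)" for v
  proof -
    have "D v = D (\<Sum>i\<in>UNIV. v $ i *\<^sub>R axis i 1)"
      using basis_expansion[of v] by (simp add: scalar_mult_eq_scaleR)
    then show ?thesis
      by (simp add: sum scaleR partial)
  qed
  then have "D = (\<lambda>v. \<Sum>i\<in>UNIV. v $ i *\<^sub>R partial_deriv i F x)"
    by blast
  with D show ?thesis
    by simp
qed

lemma has_vector_derivative_along_line:
  fixes F :: "real ^ 'd::finite \<Rightarrow> 'b::real_normed_vector"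
  assumes "\<And>x. F differentiable (at x)"
  shows "((\<lambda>h. F (x + h *\<^sub>R v)) has_vector_derivative
    (\<Sum>i\<in>UNIV. v $ i *\<^sub>R partial_deriv i F (x + h *\<^sub>R v))) (at h)"
proof -
  from has_derivative_compose[OF has_derivative_line has_derivative_partial_deriv[OF assms]]
  show ?thesis
    by (simp add: has_vector_derivative_def scaleR_sum_right)
qed

text \<open>Every remainder below is an increment of a curve \<open>\<phi>\<close> from which a
  polynomial has been subtracted, so bounding its derivative is enough.\<close>

lemma norm_increment_le:
  fixes \<phi> :: "real \<Rightarrow> 'b::real_normed_vector"
  assumes "\<And>h. (\<phi> has_vector_derivative \<phi>' h) (at h)"
    and "\<And>h. 0 \<le> h \<Longrightarrow> h \<le> b \<Longrightarrow> norm (\<phi>' h) \<le> B" and "0 \<le> b"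
  shows "norm (\<phi> b - \<phi> 0) \<le> B * b"
proof -
  have "norm (\<phi> b - \<phi> 0) \<le> B * norm (b - 0)"
  proof (rule differentiable_bound[where S = "{0..b}" and f' = "\<lambda>h r. r *\<^sub>R \<phi>' h"])
    show "(\<phi> has_derivative (\<lambda>r. r *\<^sub>R \<phi>' h)) (at h within {0..b})" for h
      using assms(1)[of h] by (auto simp: has_vector_derivative_def intro: has_derivative_at_withinI)
    \<comment> \<open>The map \<open>\<lambda>r. r *\<^sub>R w\<close> has operator norm at most
      \<open>norm w\<close>.\<close>
    show "onorm (\<lambda>r. r *\<^sub>R \<phi>' h) \<le> B" if "h \<in> {0..b}" for h
      using that by (intro onorm_le) (auto simp: mult.commute[of B] intro!: mult_left_mono assms)
  qed (use assms(3) in auto)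
  then show ?thesis using assms(3) by simp
qed

text \<open>Each component of \<open>v\<close> is at most \<open>norm v\<close>. This is where every
  Taylor estimate gains one power of \<open>norm v\<close>.\<close>

lemma norm_sum_component_scaleR_le:
  fixes v :: "real ^ 'd::finite"
  assumes "\<And>i. norm (w i) \<le> C i * e" 
  shows "norm (\<Sum>i\<in>UNIV. v $ i *\<^sub>R w i) \<le> (\<Sum>i\<in>UNIV. C i) * (norm v * e)"
proof -
  have "norm (\<Sum>i\<in>UNIV. v $ i *\<^sub>R w i) \<le> (\<Sum>i\<in>UNIV. norm v * (C i * e))"
    by (intro sum_norm_le) (auto intro!: mult_mono component_le_norm_cart assms)
  also have "\<dots> = (\<Sum>i\<in>UNIV. C i) * (norm v * e)"
    by (simp add: sum_distrib_right sum_distrib_left mult_ac)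
  finally show ?thesis .
qed

text \<open>By convexity, bounds valid on the ball apply along the whole segment of
  integration.\<close>

lemma segment_in_cball_0:
  fixes x v :: "'a::real_normed_vector"
  assumes "x \<in> cball 0 R" "x + v \<in> cball 0 R" "0 \<le> h" "h \<le> 1"
  shows "x + h *\<^sub>R v \<in> cball 0 R"
proof -
  have "(1 - h) *\<^sub>R x + h *\<^sub>R (x + v) \<in> cball 0 R"
    using assms by (intro convexD[OF convex_cball]) auto
  then show ?thesis by (simp add: algebra_simps)
qed

section \<open>Taylor remainders, uniform on closed balls\<close>

lemma C_k_1_increment_bound:
  fixes F :: "real ^ 'd::finite \<Rightarrow> 'b::real_normed_vector"
  assumes "C_k 1 F"
  shows "\<exists>C\<ge>0. \<forall>x v. x \<in> cball 0 R \<longrightarrow> x + v \<in> cball 0 R \<longrightarrow>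
       norm (F (x + v) - F x) \<le> C * norm v"
proof -
  have diff: "\<And>x. F differentiable (at x)" and cont: "\<And>i. continuous_on UNIV (partial_deriv i F)"
    using assms by auto
  \<comment> \<open>Closed balls are compact in finite dimension, so continuous partial derivatives
    are bounded on them; summing these bounds gives the constant.\<close>
  have "\<exists>M\<ge>0. \<forall>x\<in>cball 0 R. norm (partial_deriv i F x) \<le> M" for i
  proof -
    have "compact (partial_deriv i F ` cball 0 R)"
      using cont by (intro compact_continuous_image) (auto intro: continuous_on_subset)
    then obtain b where "b > 0" "\<And>y. y \<in> partial_deriv i F ` cball 0 R \<Longrightarrow> norm y \<le> b"
      using compact_imp_bounded bounded_pos by metis
    then show ?thesis
      by (intro exI[of _ b]) auto
  qed
  then obtain M where M: "\<And>i. M i \<ge> 0" "\<And>i x. x \<in> cball 0 R \<Longrightarrow> norm (partial_deriv i F x) \<le> M i"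
    by metis
  show ?thesis
  proof (intro exI[of _ "\<Sum>i\<in>UNIV. M i"] conjI allI impI)
    show "0 \<le> (\<Sum>i\<in>UNIV. M i)"
      by (simp add: sum_nonneg M)
    fix x v :: "real ^ 'd"
    assume xv: "x \<in> cball 0 R" "x + v \<in> cball 0 R"
    have "norm (F (x + 1 *\<^sub>R v) - F (x + 0 *\<^sub>R v)) \<le> ((\<Sum>i\<in>UNIV. M i) * (norm v * 1)) * 1"
    proof (rule norm_increment_le[OF has_vector_derivative_along_line[OF diff]])
      fix h :: real
      assume "0 \<le> h" "h \<le> 1"
      then have "norm (partial_deriv i F (x + h *\<^sub>R v)) \<le> M i * 1" for i
        using M(2)[OF segment_in_cball_0[OF xv]] by simp
      then show "norm (\<Sum>i\<in>UNIV. v $ i *\<^sub>R partial_deriv i F (x + h *\<^sub>R v)) \<le> (\<Sum>i\<in>UNIV. M i) * (norm v * 1)"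
        by (rule norm_sum_component_scaleR_le)
    qed simp
    then show "norm (F (x + v) - F x) \<le> (\<Sum>i\<in>UNIV. M i) * norm v"
      by simp
  qed
qed

text \<open>After subtracting the linear term, the derivative along the segment involves only
  increments of the first partial derivatives, which the increment bound makes of order
  \<open>norm v\<close>.\<close>

lemma C_k_2_taylor:
  fixes F :: "real ^ 'd::finite \<Rightarrow> 'b::real_normed_vector"
  assumes "C_k 2 F"
  shows "\<exists>C\<ge>0. \<forall>x v. x \<in> cball 0 R \<longrightarrow> x + v \<in> cball 0 R \<longrightarrow>
      
       norm (F (x + v) - F x - (\<Sum>i\<in>UNIV. v $ i *\<^sub>R partial_deriv i F x)) \<le> C * norm v ^ 2"
proof -
  have diff: "\<And>x. F differentiable (at x)" and partial: "\<And>i. C_k 1 (partial_deriv i F)"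
    using assms by (auto simp: numeral_2_eq_2)
  define r where "r = (\<lambda>i x v. partial_deriv i F (x + v) - partial_deriv i F x)"
  have "\<exists>C\<ge>0. \<forall>x v. x \<in> cball 0 R \<longrightarrow> x + v \<in> cball 0 R \<longrightarrow> norm (r i x v) \<le> C * norm v" for i
    unfolding r_def by (rule C_k_1_increment_bound[OF partial])
  then obtain M where M: "\<And>i. M i \<ge> 0" "\<And>i x v. x \<in> cball 0 R \<Longrightarrow> x + v \<in> cball 0 R \<Longrightarrow>
    norm (r i x v) \<le> M i * norm v"
    by metis
  show ?thesis
  proof (intro exI[of _ "\<Sum>i\<in>UNIV. M i"] conjI allI impI)
    show "0 \<le> (\<Sum>i\<in>UNIV. M i)"
      by (simp add: sum_nonneg M)
    fix x v :: "real ^ 'd"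
    assume xv: "x \<in> cball 0 R" "x + v \<in> cball 0 R"
    let ?\<phi> = "\<lambda>h. F (x + h *\<^sub>R v) - h *\<^sub>R (\<Sum>i\<in>UNIV. v $ i *\<^sub>R partial_deriv i F x)"
    have "norm (?\<phi> 1 - ?\<phi> 0) \<le> ((\<Sum>i\<in>UNIV. M i) * (norm v * norm v)) * 1"
    proof (rule norm_increment_le)
      show "(?\<phi> has_vector_derivative
        (\<Sum>i\<in>UNIV. v $ i *\<^sub>R r i x (h *\<^sub>R v))) (at h)" for h
        by (auto intro!: derivative_eq_intros has_vector_derivative_along_line diff
            simp: r_def scaleR_diff_right sum_subtractf)
      fix h :: real
      assume h: "0 \<le> h" "h \<le> 1"
      \<comment> \<open>Since \<open>0 \<le> h \<le> 1\<close>, shrinking the increment to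
        \<open>h *\<^sub>R v\<close> only improves the bound.\<close>
      have "norm (r i x (h *\<^sub>R v)) \<le> M i * norm v" for i
      proof -
        have "norm (r i x (h *\<^sub>R v)) \<le> M i * norm (h *\<^sub>R v)"
          by (intro M xv segment_in_cball_0 h)
        also have "\<dots> \<le> M i * norm v"
          using h by (intro mult_left_mono M) (auto simp: mult_left_le_one_le)
        finally show ?thesis .
      qed
      then show "norm (\<Sum>i\<in>UNIV. v $ i *\<^sub>R r i x (h *\<^sub>R v))
        \<le> (\<Sum>i\<in>UNIV. M i) * (norm v * norm v)"
        by (rule norm_sum_component_scaleR_le)
    qed simp
    then show "norm (F (x + v) - F x - (\<Sum>i\<in>UNIV. v $ i *\<^sub>R partial_deriv i F x))
        \<le> (\<Sum>i\<in>UNIV. M i) * norm v ^ 2"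
      by (simp add: power2_eq_square algebra_simps)
  qed
qed

text \<open>The same argument one order higher, with \<open>r i\<close> the first-order remainder of
  the partial derivative in direction \<open>i\<close>. The derivatives appear in the order in which
  they arise; their symmetry enters later.\<close>

lemma C_k_3_taylor:
  fixes F :: "real ^ 'd::finite \<Rightarrow> 'b::real_normed_vector"
  assumes "C_k 3 F"
  shows "\<exists>C\<ge>0. \<forall>x v. x \<in> cball 0 R \<longrightarrow> x + v \<in> cball 0 R \<longrightarrow>
      
       norm (F (x + v) - F x - (\<Sum>i\<in>UNIV. v $ i *\<^sub>R partial_deriv i F x)
         - (1 / 2) *\<^sub>R (\<Sum>i\<in>UNIV. v $ i *\<^sub>R (\<Sum>j\<in>UNIV. v $ j *\<^sub>R partial_deriv j (partial_deriv i F) x)))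
       \<le> C * norm v ^ 3"
proof -
  have diff: "\<And>x. F differentiable (at x)" and partial: "\<And>i. C_k 2 (partial_deriv i F)"
    using assms by (auto simp: numeral_3_eq_3 numeral_2_eq_2)
  define r where "r = (\<lambda>i x v. partial_deriv i F (x + v) - partial_deriv i F x
    - (\<Sum>j\<in>UNIV. v $ j *\<^sub>R partial_deriv j (partial_deriv i F) x))"
  have "\<exists>C\<ge>0. \<forall>x v. x \<in> cball 0 R \<longrightarrow> x + v \<in> cball 0 R \<longrightarrow> norm (r i x v) \<le> C * norm v ^ 2" for i
    unfolding r_def by (rule C_k_2_taylor[OF partial])
  then obtain M where M: "\<And>i. M i \<ge> 0" "\<And>i x v. x \<in> cball 0 R \<Longrightarrow> x + v \<in> cball 0 R \<Longrightarrow>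
    norm (r i x v) \<le> M i * norm v ^ 2"
    by metis
  show ?thesis
  proof (intro exI[of _ "\<Sum>i\<in>UNIV. M i"] conjI allI impI)
    show "0 \<le> (\<Sum>i\<in>UNIV. M i)"
      by (simp add: sum_nonneg M)
    fix x v :: "real ^ 'd"
    assume xv: "x \<in> cball 0 R" "x + v \<in> cball 0 R"
    define P where "P = (\<Sum>i\<in>UNIV. v $ i *\<^sub>R partial_deriv i F x)"
    define Q where "Q = (\<Sum>i\<in>UNIV. v $ i *\<^sub>R (\<Sum>j\<in>UNIV. v $ j *\<^sub>R partial_deriv j (partial_deriv i F) x))"
    \<comment> \<open>The factor 1/2 makes the quadratic term differentiate to
      \<open>h *\<^sub>R Q\<close>, which is the sum of the linear terms of all partial derivatives
      at \<open>h *\<^sub>R v\<close>.\<close>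
    let ?\<phi> = "\<lambda>h. F (x + h *\<^sub>R v) - h *\<^sub>R P - (h\<^sup>2 / 2) *\<^sub>R Q"
    have "norm (?\<phi> 1 - ?\<phi> 0) \<le> ((\<Sum>i\<in>UNIV. M i) * (norm v * norm v ^ 2)) * 1"
    proof (rule norm_increment_le)
      fix h :: real
      have "(\<Sum>i\<in>UNIV. v $ i *\<^sub>R r i x (h *\<^sub>R v)) =
        (\<Sum>i\<in>UNIV. v $ i *\<^sub>R partial_deriv i F (x + h *\<^sub>R v)) - P - h *\<^sub>R Q"
        unfolding P_def Q_def r_def
        by (simp add: scaleR_diff_right sum_subtractf scaleR_sum_right mult_ac)
      moreover have "((\<lambda>h. (h\<^sup>2 / 2) *\<^sub>R Q) has_vector_derivative h *\<^sub>R Q) (at h)"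
        by (auto intro!: derivative_eq_intros)
      ultimately show "(?\<phi> has_vector_derivative (\<Sum>i\<in>UNIV. v $ i *\<^sub>R r i x (h *\<^sub>R v))) (at h)"
        by (auto intro!: derivative_eq_intros has_vector_derivative_along_line diff)
      assume h: "0 \<le> h" "h \<le> 1"
      have "norm (r i x (h *\<^sub>R v)) \<le> M i * norm v ^ 2" for i
      proof -
        have "norm (r i x (h *\<^sub>R v)) \<le> M i * norm (h *\<^sub>R v) ^ 2"
          by (intro M xv segment_in_cball_0 h)
        also have "\<dots> \<le> M i * norm v ^ 2"
          using h by (intro mult_left_mono M power_mono) (auto simp: mult_left_le_one_le)
        finally show ?thesis .
      qed
      then show "norm (\<Sum>i\<in>UNIV. v $ i *\<^sub>R r i x (h *\<^sub>R v)) \<le> (\<Sum>i\<in>UNIV. M i) * (norm v * norm v ^ 2)"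
        by (rule norm_sum_component_scaleR_le)
    qed simp
    also have "?\<phi> 1 - ?\<phi> 0 = F (x + v) - F x - P - (1 / 2) *\<^sub>R Q"
      by (simp add: algebra_simps)
    finally have "norm (F (x + v) - F x - P - (1 / 2) *\<^sub>R Q) \<le> (\<Sum>i\<in>UNIV. M i) * norm v ^ 3"
      by (simp add: power2_eq_square power3_eq_cube mult_ac)
    then show "norm (F (x + v) - F x - (\<Sum>i\<in>UNIV. v $ i *\<^sub>R partial_deriv i F x)
         - (1 / 2) *\<^sub>R (\<Sum>i\<in>UNIV. v $ i *\<^sub>R (\<Sum>j\<in>UNIV. v $ j *\<^sub>R partial_deriv j (partial_deriv i F) x)))
       \<le> (\<Sum>i\<in>UNIV. M i) * norm v ^ 3"
      unfolding P_def Q_def .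
  qed
qed

section \<open>Symmetry of mixed partial derivatives\<close>

lemma sum_axis_scaleR:
  fixes f :: "'d::finite \<Rightarrow> 'b::real_vector"
  shows "(\<Sum>i\<in>UNIV. (c *\<^sub>R axis j (1::real)) $ i *\<^sub>R f i) = c *\<^sub>R f j"
proof -
  have "(\<Sum>i\<in>UNIV. (c *\<^sub>R axis j (1::real)) $ i *\<^sub>R f i) = (\<Sum>i\<in>UNIV. if i = j then c *\<^sub>R f i else 0)"
    by (intro sum.cong) (auto simp: axis_def)
  then show ?thesis by simp
qed

text \<open>The second difference is symmetric in \<open>i\<close> and \<open>j\<close>, which is what makes the mixed
  derivatives agree.\<close>

lemma second_difference_bound:
  fixes F :: "real ^ 'd::finite \<Rightarrow> 'b::real_normed_vector"
  assumes "C_k 3 F"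
  shows "\<exists>C. \<forall>h. 0 \<le> h \<longrightarrow> h \<le> 1 \<longrightarrow>
    norm (F (x + h *\<^sub>R axis i 1 + h *\<^sub>R axis j 1) - F (x + h *\<^sub>R axis i 1) - F (x + h *\<^sub>R axis j 1) + F x
      - h\<^sup>2 *\<^sub>R partial_deriv i (partial_deriv j F) x) \<le> C * h ^ 3"
proof -
  have diff: "\<And>x. F differentiable (at x)" and C2: "C_k 2 (partial_deriv j F)"
    and C1: "C_k 1 (partial_deriv i (partial_deriv j F))"
    using assms by (auto simp: numeral_3_eq_3 numeral_2_eq_2)
  \<comment> \<open>All evaluation points are \<open>x\<close> plus at most two steps of length at
    most 1.\<close>
  let ?R = "norm x + 2"
  let ?G = "partial_deriv j F"
  let ?H = "partial_deriv i ?G"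
  obtain A where A: "A \<ge> 0" "\<And>x v. x \<in> cball 0 ?R \<Longrightarrow> x + v \<in> cball 0 ?R \<Longrightarrow>
       norm (?G (x + v) - ?G x - (\<Sum>i\<in>UNIV. v $ i *\<^sub>R partial_deriv i ?G x)) \<le> A * norm v ^ 2"
    using C_k_2_taylor[OF C2, of ?R] by blast
  obtain B where B: "B \<ge> 0" "\<And>x v. x \<in> cball 0 ?R \<Longrightarrow> x + v \<in> cball 0 ?R \<Longrightarrow>
       norm (?H (x + v) - ?H x) \<le> B * norm v"
    using C_k_1_increment_bound[OF C1, of ?R] by blast
  show ?thesis
  proof (intro exI[of _ "A + B"] allI impI)
    fix h :: real
    assume h: "0 \<le> h" "h \<le> 1"
    define a b where "a = (axis i 1 :: real ^ 'd)" and "b = (axis j 1 :: real ^ 'd)"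
    have norms: "norm a = 1" "norm b = 1"
      by (simp_all add: a_def b_def norm_axis_1)
    \<comment> \<open>View the second difference as the increment in direction \<open>b\<close> of a
      difference in direction \<open>a\<close>. Its derivative is of order \<open>h\<^sup>2\<close>,
      and integrating over length \<open>h\<close> gives the cube.\<close>
    let ?\<phi> = "\<lambda>u. F (x + h *\<^sub>R a + u *\<^sub>R b) - F (x + u *\<^sub>R b) - (u * h) *\<^sub>R ?H x"
    let ?\<phi>' = "\<lambda>u. ?G (x + h *\<^sub>R a + u *\<^sub>R b) - ?G (x + u *\<^sub>R b) - h *\<^sub>R ?H x"
    have deriv: "((\<lambda>u. F (y + u *\<^sub>R b)) has_vector_derivative ?G (y + u *\<^sub>R b)) (at u)" for y u
      using has_vector_derivative_along_line[OF diff, of y b u]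
        sum_axis_scaleR[of 1 j "\<lambda>i. partial_deriv i F (y + u *\<^sub>R b)"] by (simp add: b_def)
    have "norm (?\<phi> h - ?\<phi> 0) \<le> ((A + B) * h\<^sup>2) * h"
    proof (rule norm_increment_le)
      show "(?\<phi> has_vector_derivative ?\<phi>' u) (at u)" for u
      proof -
        have "((\<lambda>u. (u * h) *\<^sub>R ?H x) has_vector_derivative h *\<^sub>R ?H x) (at u)"
          by (auto intro!: derivative_eq_intros)
        then show ?thesis
          by (intro has_vector_derivative_diff deriv)
      qed
      fix u :: real
      assume u: "0 \<le> u" "u \<le> h"
      have "norm (x + u *\<^sub>R b) \<le> norm x + u" "norm (x + u *\<^sub>R b + h *\<^sub>R a) \<le> norm x + u + h"
        using u h norm_triangle_ineq[of x "u *\<^sub>R b"] norm_triangle_ineq[of "x + u *\<^sub>R b" "h *\<^sub>R a"]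
        by (auto simp: norms)
      then have mem: "x \<in> cball 0 ?R" "x + u *\<^sub>R b \<in> cball 0 ?R" "x + u *\<^sub>R b + h *\<^sub>R a \<in> cball 0 ?R"
        using u h by auto
      \<comment> \<open>\<open>?p\<close> is the Taylor remainder at the shifted base point;
        \<open>?q\<close> moves the second derivative back to \<open>x\<close>. Both are of order
        \<open>h\<^sup>2\<close>.\<close>
      let ?p = "?G (x + u *\<^sub>R b + h *\<^sub>R a) - ?G (x + u *\<^sub>R b) - h *\<^sub>R ?H (x + u *\<^sub>R b)"
      let ?q = "h *\<^sub>R (?H (x + u *\<^sub>R b) - ?H x)"
      have "norm ?p \<le> A * norm (h *\<^sub>R a) ^ 2"
        using A(2)[OF mem(2,3)] unfolding a_def sum_axis_scaleR .
      then have p: "norm ?p \<le> A * h\<^sup>2"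
        by (simp add: norms)
      have "norm (?H (x + u *\<^sub>R b) - ?H x) \<le> B * norm (u *\<^sub>R b)"
        by (intro B mem)
      also have "\<dots> \<le> B * h"
        using u by (intro mult_left_mono B) (auto simp: norms)
      finally have "norm ?q \<le> h * (B * h)"
        using h by (auto intro: mult_left_mono)
      with p have "norm ?p + norm ?q \<le> (A + B) * h\<^sup>2"
        by (simp add: power2_eq_square algebra_simps)
      moreover have "?\<phi>' u = ?p + ?q"
        by (simp add: scaleR_diff_right add_ac)
      ultimately show "norm (?\<phi>' u) \<le> (A + B) * h\<^sup>2"
        by (metis norm_triangle_le)
    qed fact
    also have "?\<phi> h - ?\<phi> 0 =
        F (x + h *\<^sub>R a + h *\<^sub>R b) - F (x + h *\<^sub>R a) - F (x + h *\<^sub>R b) + F x - h\<^sup>2 *\<^sub>R ?H x"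
      by (simp add: power2_eq_square)
    finally show "norm (F (x + h *\<^sub>R axis i 1 + h *\<^sub>R axis j 1) - F (x + h *\<^sub>R axis i 1)
        - F (x + h *\<^sub>R axis j 1) + F x - h\<^sup>2 *\<^sub>R ?H x) \<le> (A + B) * h ^ 3"
      by (simp add: a_def b_def power2_eq_square power3_eq_cube mult_ac)
  qed
qed

text \<open>Both derivatives approximate the same second difference divided by
  \<open>h\<^sup>2\<close> with error of order \<open>h\<close>; let \<open>h\<close> tend to 0 from
  the right.\<close>

lemma partial_deriv_commute:
  fixes F :: "real ^ 'd::finite \<Rightarrow> 'b::real_normed_vector"
  assumes "C_k 3 F"
  shows "partial_deriv i (partial_deriv j F) x = partial_deriv j (partial_deriv i F) x"
proof -
  let ?D = "\<lambda>i j h. F (x + h *\<^sub>R axis i 1 + h *\<^sub>R axis j 1) - F (x + h *\<^sub>R axis i 1) - F (x + h *\<^sub>R axis j 1) + F x"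
  let ?a = "partial_deriv i (partial_deriv j F) x"
  let ?b = "partial_deriv j (partial_deriv i F) x"
  obtain A where A: "\<forall>h. 0 \<le> h \<longrightarrow> h \<le> 1 \<longrightarrow> norm (?D i j h - h\<^sup>2 *\<^sub>R ?a) \<le> A * h ^ 3"
    using second_difference_bound[OF assms, of x i j] by blast
  obtain B where B: "\<forall>h. 0 \<le> h \<longrightarrow> h \<le> 1 \<longrightarrow> norm (?D j i h - h\<^sup>2 *\<^sub>R ?b) \<le> B * h ^ 3"
    using second_difference_bound[OF assms, of x j i] by blast
  have bound: "norm (?a - ?b) \<le> (A + B) * h" if h: "0 < h" "h \<le> 1" for h
  proof -
    have "h\<^sup>2 * norm (?a - ?b) = norm ((?D j i h - h\<^sup>2 *\<^sub>R ?b) - (?D i j h - h\<^sup>2 *\<^sub>R ?a))"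
    proof -
      have "(?D j i h - h\<^sup>2 *\<^sub>R ?b) - (?D i j h - h\<^sup>2 *\<^sub>R ?a) = h\<^sup>2 *\<^sub>R (?a - ?b)"
        by (simp add: algebra_simps)
      then show ?thesis by simp
    qed
    also have "\<dots> \<le> B * h ^ 3 + A * h ^ 3"
      using h by (intro norm_triangle_le_diff add_mono A[rule_format] B[rule_format]) auto
    also have "\<dots> = h\<^sup>2 * ((A + B) * h)"
      by (simp add: power2_eq_square power3_eq_cube algebra_simps)
    finally show ?thesis using h by simp
  qed
  have "((\<lambda>h. (A + B) * h) \<longlongrightarrow> (A + B) * 0) (at_right 0)"
    by (intro tendsto_intros)
  moreover have "\<forall>\<^sub>F h in at_right 0. norm (?a - ?b) \<le> (A + B) * h"
    using bound by (auto simp: eventually_at_right_field intro!: exI[of _ 1])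
  ultimately have "norm (?a - ?b) \<le> (A + B) * 0"
    by (rule tendsto_lowerbound) simp
  then show ?thesis by simp
qed

section \<open>Controlledness\<close>

text \<open>Right factor \<open>[]\<close> occurs exactly once in each of these coproducts, in the
  term that cuts off everything.\<close>

lemma pairing_vec_star_empty:
  fixes x :: "'a::finite forest \<Rightarrow>\<^sub>0 real" and Y :: "('a forest \<Rightarrow>\<^sub>0 real) ^ 'n"
  assumes "2 \<le> N" and "\<And>k. Poly_Mapping.keys (Y $ k) \<subseteq> forests_le 2"
  shows "pairing_vec (star N x (basis [])) Y =
    Poly_Mapping.lookup x [] *\<^sub>R pairing_vec (basis []) Y
    + (\<Sum>i\<in>UNIV. Poly_Mapping.lookup x [bullet i] *\<^sub>R pairing_vec (basis [bullet i]) Y)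
    + (\<Sum>i\<in>UNIV. \<Sum>j\<in>UNIV. Poly_Mapping.lookup x [bullet i, bullet j] *\<^sub>R pairing_vec (basis [bullet i, bullet j]) Y)
    + (\<Sum>i\<in>UNIV. \<Sum>j\<in>UNIV. Poly_Mapping.lookup x [Node i [bullet j]] *\<^sub>R pairing_vec (basis [Node i [bullet j]]) Y)"
  by (simp add: pairing_vec_star[OF assms] sum_forests_le_2 coproduct_bullet coproduct_bullet_bullet
      coproduct_ladder lookup_tensor_basis)

text \<open>Right factor \<open>[bullet k]\<close> arises from the empty cut of
  \<open>[bullet k]\<close>, from cutting the left one of two bullets, and from cutting the leaf of
  a ladder with root \<open>k\<close>.\<close>

lemma pairing_vec_star_bullet:
  fixes x :: "'a::finite forest \<Rightarrow>\<^sub>0 real" and Y :: "('a forest \<Rightarrow>\<^sub>0 real) ^ 'n"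
  assumes "2 \<le> N" and "\<And>k. Poly_Mapping.keys (Y $ k) \<subseteq> forests_le 2"
  shows "pairing_vec (star N x (basis [bullet k])) Y =
    Poly_Mapping.lookup x [] *\<^sub>R pairing_vec (basis [bullet k]) Y
    + (\<Sum>i\<in>UNIV. Poly_Mapping.lookup x [bullet i] *\<^sub>R pairing_vec (basis [bullet i, bullet k]) Y)
    + (\<Sum>j\<in>UNIV. Poly_Mapping.lookup x [bullet j] *\<^sub>R pairing_vec (basis [Node k [bullet j]]) Y)"
proof -
  \<comment> \<open>For ladders the selected index is the root, hence the outer one; swapping the
    sums lets the conditional collapse.\<close>
  have "(\<Sum>i\<in>UNIV. \<Sum>j\<in>UNIV. (if i = k then g i j else 0)) = (\<Sum>j\<in>UNIV. g k j)"
    for g :: "'a \<Rightarrow> 'a \<Rightarrow> real ^ 'n"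
    by (subst sum.swap) simp
  then show ?thesis
    by (simp add: pairing_vec_star[OF assms] sum_forests_le_2 coproduct_bullet coproduct_bullet_bullet
        coproduct_ladder lookup_tensor_basis if_distrib[where f = "\<lambda>c. c *\<^sub>R _"] cong: if_cong)
qed

text \<open>Among forests with at most two vertices, a right factor of size two comes only from the
  empty cut.\<close>

lemma pairing_vec_star_two_vertices:
  fixes x :: "'a::finite forest \<Rightarrow>\<^sub>0 real" and Y :: "('a forest \<Rightarrow>\<^sub>0 real) ^ 'n"
  assumes "2 \<le> N" and "\<And>k. Poly_Mapping.keys (Y $ k) \<subseteq> forests_le 2" and "vertices \<tau> = 2"
  shows "pairing_vec (star N x (basis \<tau>)) Y = Poly_Mapping.lookup x [] *\<^sub>R pairing_vec (basis \<tau>) Y"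
proof -
  have "pairing (tensor x (basis \<tau>)) (coproduct \<sigma>) = (if \<sigma> = \<tau> then Poly_Mapping.lookup x [] else 0)"
    if "\<sigma> \<in> forests_le 2" for \<sigma>
  proof -
    have "vertices \<sigma> \<le> 2" using that by (simp add: forests_le_def)
    then show ?thesis
      using assms(3)
      by (cases rule: vertices_le_2_cases)
        (auto simp: coproduct_bullet coproduct_bullet_bullet coproduct_ladder lookup_tensor_basis)
  qed
  then have "pairing_vec (star N x (basis \<tau>)) Y =
      (\<Sum>\<sigma>\<in>forests_le 2. if \<sigma> = \<tau> then Poly_Mapping.lookup x [] *\<^sub>R pairing_vec (basis \<sigma>) Y else 0)"
    by (auto simp: pairing_vec_star[OF assms(1,2)] intro!: sum.cong)
  moreover have "\<tau> \<in> forests_le 2"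
    using assms(3) by (simp add: forests_le_def)
  ultimately show ?thesis
    by (simp add: finite_forests_le)
qed

text \<open>By symmetry of \<open>H\<close>, transposing \<open>l\<close> does not change the sum;
  averaging the two versions replaces \<open>l i j\<close> by half of \<open>v i * v j\<close>. The
  right side uses \<open>H j i\<close> to match the Taylor polynomial.\<close>

lemma sum_scaleR_symmetric:
  fixes H :: "'a::finite \<Rightarrow> 'a \<Rightarrow> 'b::real_vector"
  assumes "\<And>i j. H i j = H j i" and "\<And>i j. l i j + l j i = v i * v j"
  shows "(\<Sum>i\<in>UNIV. \<Sum>j\<in>UNIV. l i j *\<^sub>R H i j)
    = (1 / 2) *\<^sub>R (\<Sum>i\<in>UNIV. v i *\<^sub>R (\<Sum>j\<in>UNIV. v j *\<^sub>R H j i))"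
proof -
  let ?S = "\<Sum>i\<in>UNIV. \<Sum>j\<in>UNIV. l i j *\<^sub>R H i j"
  have "?S = (\<Sum>i\<in>UNIV. \<Sum>j\<in>UNIV. l j i *\<^sub>R H i j)"
    using assms(1) by (subst sum.swap) simp
  then have "?S + ?S = (\<Sum>i\<in>UNIV. \<Sum>j\<in>UNIV. (l i j + l j i) *\<^sub>R H i j)"
    by (simp add: scaleR_add_left sum.distrib)
  also have "\<dots> = (\<Sum>i\<in>UNIV. v i *\<^sub>R (\<Sum>j\<in>UNIV. v j *\<^sub>R H j i))"
    by (simp add: assms(2) scaleR_sum_right assms(1)[of _ i for i])
  finally have "?S + ?S = (\<Sum>i\<in>UNIV. v i *\<^sub>R (\<Sum>j\<in>UNIV. v j *\<^sub>R H j i))" .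
  moreover have "?S = (1 / 2) *\<^sub>R (?S + ?S)"
    by (simp flip: scaleR_2)
  ultimately show ?thesis by simp
qed

text \<open>The regularity condition at \<open>[bullet i]\<close>, which lies in the truncation as
  the level is at least 1, is Hoelder continuity of the component \<open>i\<close>; the components
  are combined through the l1 norm.\<close>

lemma rough_path_increment_bound:
  fixes X :: "real \<Rightarrow> real ^ 'd::finite"
  assumes "planarly_branched_rough_path \<alpha> T \<XX>" "rough_path_above T \<XX> X" "1 \<le> level \<alpha>"
  obtains C where "C \<ge> 0" "\<And>s t. s \<in> {0..T} \<Longrightarrow> t \<in> {0..T} \<Longrightarrow> norm (X t - X s) \<le> C * \<bar>t - s\<bar> powr \<alpha>"
proof -
  have "\<exists>K. \<forall>s\<in>{0..T}. \<forall>t\<in>{0..T}. s \<noteq> t \<longrightarrow> \<bar>X t $ i - X s $ i\<bar> / \<bar>t - s\<bar> powr \<alpha> \<le> K" for i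
  proof -
    have "[bullet i] \<in> forests_le (level \<alpha>)"
      using assms(3) by (simp add: forests_le_def)
    moreover have "\<forall>\<tau>\<in>forests_le (level \<alpha>).
        bdd_above {\<bar>pairing (\<XX> s t) (basis \<tau>)\<bar> / \<bar>t - s\<bar> powr (real (vertices \<tau>) * \<alpha>) | s t.
          s \<in> {0..T} \<and> t \<in> {0..T} \<and> s \<noteq> t}"
      using assms(1) unfolding planarly_branched_rough_path_def by (elim conjE)
    ultimately have "bdd_above {\<bar>pairing (\<XX> s t) (basis [bullet i])\<bar> / \<bar>t - s\<bar> powr (real (vertices [bullet i]) * \<alpha>) | s t.
          s \<in> {0..T} \<and> t \<in> {0..T} \<and> s \<noteq> t}"
      by (rule bspec[rotated])
    then obtain K where K: "\<And>s t. s \<in> {0..T} \<Longrightarrow> t \<in> {0..T} \<Longrightarrow> s \<noteq> t \<Longrightarrow>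
        \<bar>pairing (\<XX> s t) (basis [bullet i])\<bar> / \<bar>t - s\<bar> powr (real (vertices [bullet i]) * \<alpha>) \<le> K"
      unfolding bdd_above_def by blast
    show ?thesis
    proof (intro exI ballI impI)
      fix s t assume st: "s \<in> {0..T}" "t \<in> {0..T}" "s \<noteq> t"
      have "pairing (\<XX> s t) (basis [bullet i]) = X t $ i - X s $ i"
        using assms(2) st unfolding rough_path_above_def by blast
      then show "\<bar>X t $ i - X s $ i\<bar> / \<bar>t - s\<bar> powr \<alpha> \<le> K"
        using K[OF st] by simp
    qed
  qed
  then obtain K where K: "\<And>i s t. s \<in> {0..T} \<Longrightarrow> t \<in> {0..T} \<Longrightarrow> s \<noteq> t \<Longrightarrow>
      \<bar>X t $ i - X s $ i\<bar> / \<bar>t - s\<bar> powr \<alpha> \<le> K i"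
    by metis
  show ?thesis
  proof (rule that)
    \<comment> \<open>The bounds \<open>K i\<close> come without a sign, hence the absolute
      values.\<close>
    show "0 \<le> (\<Sum>i\<in>UNIV. \<bar>K i\<bar>)"
      by (simp add: sum_nonneg)
    fix s t assume st: "s \<in> {0..T}" "t \<in> {0..T}"
    have "\<bar>(X t - X s) $ i\<bar> \<le> \<bar>K i\<bar> * \<bar>t - s\<bar> powr \<alpha>" for i
    \<comment> \<open>On the diagonal both sides are 0, as
      \<open>0 powr \<alpha> = 0\<close>.\<close>
    proof (cases "s = t")
      case False
      then have "\<bar>X t $ i - X s $ i\<bar> \<le> K i * \<bar>t - s\<bar> powr \<alpha>"
        using K[OF st False, of i] by (simp add: pos_divide_le_eq)
      also have "\<dots> \<le> \<bar>K i\<bar> * \<bar>t - s\<bar> powr \<alpha>"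
        by (intro mult_right_mono) auto
      finally show ?thesis by simp
    qed simp
    then have "(\<Sum>i\<in>UNIV. \<bar>(X t - X s) $ i\<bar>) \<le> (\<Sum>i\<in>UNIV. \<bar>K i\<bar> * \<bar>t - s\<bar> powr \<alpha>)"
      by (rule sum_mono)
    then show "norm (X t - X s) \<le> (\<Sum>i\<in>UNIV. \<bar>K i\<bar>) * \<bar>t - s\<bar> powr \<alpha>"
      using norm_le_l1_cart[of "X t - X s"] by (simp add: sum_distrib_right)
  qed
qed

section \<open>Remainder estimates for each forest shape\<close>

theorem proposition2p9:
  fixes \<alpha> T :: real
    and \<XX> :: "real \<Rightarrow> real \<Rightarrow> 'd::finite forest \<Rightarrow>\<^sub>0 real"
    and X :: "real \<Rightarrow> real ^ 'd"
    and F :: "real ^ 'd \<Rightarrow> real ^ 'n"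
    and Z :: "real \<Rightarrow> ('d forest \<Rightarrow>\<^sub>0 real) ^ 'n"
  assumes "0 \<le> T"
    and "1 / 4 < \<alpha>" and "\<alpha> \<le> 1 / 3"
    and "planarly_branched_rough_path \<alpha> T \<XX>"
    and "rough_path_above T \<XX> X"
    and "smooth F"
    and "\<And>t k. t \<in> {0..T} \<Longrightarrow> Poly_Mapping.keys (Z t $ k) \<subseteq> forests_le 2"
    and "\<And>t. t \<in> {0..T} \<Longrightarrow> pairing_vec (basis []) (Z t) = F (X t)"
    and "\<And>t i. t \<in> {0..T} \<Longrightarrow> pairing_vec (basis [bullet i]) (Z t) = partial_deriv i F (X t)"
    and "\<And>t i j. t \<in> {0..T} \<Longrightarrow>
           pairing_vec (basis [bullet i, bullet j]) (Z t) = partial_deriv i (partial_deriv j F) (X t)"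
    and "\<And>t i j. t \<in> {0..T} \<Longrightarrow> pairing_vec (basis [Node i [bullet j]]) (Z t) = 0"
  shows "controlled_path \<alpha> T \<XX> Z \<and> controlled_path_above T Z (\<lambda>t. F (X t))"
proof
  note rough = assms(4) and above = assms(5)
  have level: "level \<alpha> = 3"
  proof -
    have "\<lfloor>1 / \<alpha>\<rfloor> = 3"
      using assms(2,3) by (intro floor_unique) (auto simp: field_simps)
    then show ?thesis by (simp add: level_def)
  qed
  have \<alpha>: "0 < \<alpha>" using assms(2) by simp
  have C_k: "C_k k F" for k
    using assms(6) by (simp add: smooth_def)
  have C_k_partial: "C_k k (partial_deriv i F)" "C_k k (partial_deriv i (partial_deriv j F))" for k i j
    using C_k[of "Suc k"] C_k[of "Suc (Suc k)"] by auto
  obtain K where K: "K \<ge> 0" "\<And>s t. s \<in> {0..T} \<Longrightarrow> t \<in> {0..T} \<Longrightarrow> norm (X t - X s) \<le> K * \<bar>t - s\<bar> powr \<alpha>"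
    using rough_path_increment_bound[OF rough above] level by auto
  \<comment> \<open>\<open>0 < m\<close> matters on the diagonal: there the right side is 0, so the
    power on the left must vanish too.\<close>
  have K_pow: "norm (X t - X s) ^ m \<le> K ^ m * \<bar>t - s\<bar> powr (real m * \<alpha>)"
    if "s \<in> {0..T}" "t \<in> {0..T}" "0 < m" for s t m
  proof -
    have "norm (X t - X s) ^ m \<le> (K * \<bar>t - s\<bar> powr \<alpha>) ^ m"
      using K(2) that by (intro power_mono) auto
    also have "\<dots> = K ^ m * \<bar>t - s\<bar> powr (real m * \<alpha>)"
      using that by (cases "s = t")
        (simp_all add: power_mult_distrib powr_power mult.commute)
    finally show ?thesis .
  qed
  \<comment> \<open>Hoelder continuity from time 0 confines the whole path to one ball, so the
    Taylor constants are uniform in \<open>s\<close> and \<open>t\<close>.\<close>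
  define R where "R = norm (X 0) + K * T powr \<alpha>"
  have X_mem: "X t \<in> cball 0 R" if "t \<in> {0..T}" for t
  proof -
    have "norm (X t) \<le> norm (X 0) + norm (X t - X 0)"
      using norm_triangle_sub[of "X t" "X 0"] by simp
    also have "norm (X t - X 0) \<le> K * \<bar>t - 0\<bar> powr \<alpha>"
      using that assms(1) by (intro K(2)) auto
    also have "\<dots> \<le> K * T powr \<alpha>"
      using that \<alpha> K(1) by (intro mult_left_mono powr_mono2) auto
    finally show ?thesis by (simp add: R_def)
  qed
  have X_mem': "X s + (X t - X s) \<in> cball 0 R" if "t \<in> {0..T}" for s t
    using X_mem[OF that] by simp
  have lookup_empty: "Poly_Mapping.lookup (\<XX> s t) [] = 1"
    and lookup_bullet: "Poly_Mapping.lookup (\<XX> s t) [bullet i] = (X t - X s) $ i"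
    and lookup_bullets: "Poly_Mapping.lookup (\<XX> s t) [bullet i, bullet j]
      + Poly_Mapping.lookup (\<XX> s t) [bullet j, bullet i] = (X t - X s) $ i * (X t - X s) $ j"
    if st: "s \<in> {0..T}" "t \<in> {0..T}" for s t i j
  proof -
    show "Poly_Mapping.lookup (\<XX> s t) [] = 1"
      using rough st unfolding planarly_branched_rough_path_def by simp
    have bullet: "Poly_Mapping.lookup (\<XX> s t) [bullet i] = (X t - X s) $ i" for i
      using above st unfolding rough_path_above_def by simp
    then show "Poly_Mapping.lookup (\<XX> s t) [bullet i] = (X t - X s) $ i" .
    have "vertices [bullet i] + vertices [bullet j] \<le> level \<alpha>"
      by (simp add: level)
    then have "pairing (\<XX> s t) (shuffle [bullet i] [bullet j]) =
        pairing (\<XX> s t) (basis [bullet i]) * pairing (\<XX> s t) (basis [bullet j])"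
      using rough st unfolding planarly_branched_rough_path_def by blast
    then show "Poly_Mapping.lookup (\<XX> s t) [bullet i, bullet j]
      + Poly_Mapping.lookup (\<XX> s t) [bullet j, bullet i] = (X t - X s) $ i * (X t - X s) $ j"
      by (simp only: pairing_shuffle_bullets pairing_basis_right bullet)
  qed
  note Z = assms(7-11)
  show "controlled_path_above T Z (\<lambda>t. F (X t))"
    using Z(2) by (simp add: controlled_path_above_def)
  define r where "r = (\<lambda>\<tau> s t. pairing_vec (basis \<tau>) (Z t) - pairing_vec (star (level \<alpha>) (\<XX> s t) (basis \<tau>)) (Z s))"
  \<comment> \<open>Turns an estimate of order \<open>m\<close> in the increment of \<open>X\<close>
    into the exponent \<open>m * \<alpha>\<close> in time; it is applied with \<open>m\<close> equal
    to 3 minus the number of vertices.\<close>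
  have bound: "\<exists>C. \<forall>s\<in>{0..T}. \<forall>t\<in>{0..T}. norm (r \<tau> s t) \<le> C * \<bar>t - s\<bar> powr (real m * \<alpha>)"
    if "0 < m" "0 \<le> C"
      "\<And>s t. s \<in> {0..T} \<Longrightarrow> t \<in> {0..T} \<Longrightarrow> norm (r \<tau> s t) \<le> C * norm (X t - X s) ^ m" for \<tau> m C
  proof (intro exI ballI)
    fix s t assume st: "s \<in> {0..T}" "t \<in> {0..T}"
    have "norm (r \<tau> s t) \<le> C * norm (X t - X s) ^ m"
      using that st by blast
    also have "\<dots> \<le> C * (K ^ m * \<bar>t - s\<bar> powr (real m * \<alpha>))"
      using that st by (intro mult_left_mono K_pow) auto
    finally show "norm (r \<tau> s t) \<le> C * K ^ m * \<bar>t - s\<bar> powr (real m * \<alpha>)"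
      by (simp add: mult.assoc)
  qed
  have "\<exists>C. \<forall>s\<in>{0..T}. \<forall>t\<in>{0..T}. norm (r \<tau> s t) \<le> C * \<bar>t - s\<bar> powr (real (level \<alpha> - vertices \<tau>) * \<alpha>)"
    if "vertices \<tau> \<le> 2" for \<tau>
    using that
  proof (cases rule: vertices_le_2_cases)
    case 1
    from C_k_3_taylor[OF C_k, of R] obtain C where C: "C \<ge> 0" "\<forall>x v. x \<in> cball 0 R \<longrightarrow> x + v \<in> cball 0 R \<longrightarrow>
       norm (F (x + v) - F x - (\<Sum>i\<in>UNIV. v $ i *\<^sub>R partial_deriv i F x)
         - (1 / 2) *\<^sub>R (\<Sum>i\<in>UNIV. v $ i *\<^sub>R (\<Sum>j\<in>UNIV. v $ j *\<^sub>R partial_deriv j (partial_deriv i F) x)))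
       \<le> C * norm v ^ 3"
      by blast
    have "norm (r \<tau> s t) \<le> C * norm (X t - X s) ^ 3" if st: "s \<in> {0..T}" "t \<in> {0..T}" for s t
    proof -
      \<comment> \<open>Only the symmetrised level-two coefficients are known, and commuting second
        derivatives make them sufficient.\<close>
      have "(\<Sum>i\<in>UNIV. \<Sum>j\<in>UNIV. Poly_Mapping.lookup (\<XX> s t) [bullet i, bullet j] *\<^sub>R
            partial_deriv i (partial_deriv j F) (X s))
          = (1 / 2) *\<^sub>R (\<Sum>i\<in>UNIV. (X t - X s) $ i *\<^sub>R
            (\<Sum>j\<in>UNIV. (X t - X s) $ j *\<^sub>R partial_deriv j (partial_deriv i F) (X s)))"
        by (rule sum_scaleR_symmetric[OF partial_deriv_commute[OF C_k] lookup_bullets[OF st]])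
      then have "r \<tau> s t = F (X s + (X t - X s)) - F (X s) - (\<Sum>i\<in>UNIV. (X t - X s) $ i *\<^sub>R partial_deriv i F (X s))
         - (1 / 2) *\<^sub>R (\<Sum>i\<in>UNIV. (X t - X s) $ i *\<^sub>R
            (\<Sum>j\<in>UNIV. (X t - X s) $ j *\<^sub>R partial_deriv j (partial_deriv i F) (X s)))"
        unfolding r_def 1 level
        by (subst pairing_vec_star_empty) (simp_all add: st Z lookup_empty lookup_bullet diff_diff_eq del: atLeastAtMost_iff)
      then show ?thesis
        using C(2)[rule_format, OF X_mem X_mem'] st by simp
    qed
    from bound[OF _ C(1) this] show ?thesis
      by (simp add: 1 level)
  next
    case (2 i)
    from C_k_2_taylor[OF C_k_partial(1), of R i] obtain C where C: "C \<ge> 0" "\<forall>x v. x \<in> cball 0 R \<longrightarrow> x + v \<in> cball 0 R \<longrightarrow>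
       norm (partial_deriv i F (x + v) - partial_deriv i F x
         - (\<Sum>j\<in>UNIV. v $ j *\<^sub>R partial_deriv j (partial_deriv i F) x)) \<le> C * norm v ^ 2"
      by blast
    have "norm (r \<tau> s t) \<le> C * norm (X t - X s) ^ 2" if st: "s \<in> {0..T}" "t \<in> {0..T}" for s t
    proof -
      \<comment> \<open>The forest \<open>[bullet j, bullet i]\<close> carries the derivative in
        direction \<open>j\<close> of the one in direction \<open>i\<close>, as in the Taylor
        polynomial; the ladder terms vanish.\<close>
      have "r \<tau> s t = partial_deriv i F (X s + (X t - X s)) - partial_deriv i F (X s)
         - (\<Sum>j\<in>UNIV. (X t - X s) $ j *\<^sub>R partial_deriv j (partial_deriv i F) (X s))"
        unfolding r_def 2 level
        by (subst pairing_vec_star_bullet) (simp_all add: st Z lookup_empty lookup_bullet diff_diff_eq del: atLeastAtMost_iff)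
      then show ?thesis
        using C(2)[rule_format, OF X_mem X_mem'] st by simp
    qed
    from bound[OF _ C(1) this] show ?thesis
      by (simp add: 2 level)
  next
    case (3 i j)
    from C_k_1_increment_bound[OF C_k_partial(2), of R i j] obtain C where C: "C \<ge> 0" "\<forall>x v. x \<in> cball 0 R \<longrightarrow> x + v \<in> cball 0 R \<longrightarrow>
       norm (partial_deriv i (partial_deriv j F) (x + v) - partial_deriv i (partial_deriv j F) x) \<le> C * norm v"
      by blast
    have "norm (r \<tau> s t) \<le> C * norm (X t - X s) ^ 1" if st: "s \<in> {0..T}" "t \<in> {0..T}" for s t
    proof -
      have "r \<tau> s t = partial_deriv i (partial_deriv j F) (X s + (X t - X s)) - partial_deriv i (partial_deriv j F) (X s)"
        unfolding r_def 3 level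
        by (subst pairing_vec_star_two_vertices) (simp_all add: st Z lookup_empty del: atLeastAtMost_iff)
      then show ?thesis
        using C(2)[rule_format, OF X_mem X_mem'] st by simp
    qed
    from bound[OF _ C(1) this] show ?thesis
      by (simp add: 3 level)
  next
    case (4 i j)
    \<comment> \<open>The ladder components of \<open>Z\<close> vanish at both times, so constant 0
      works.\<close>
    have "r \<tau> s t = 0" if st: "s \<in> {0..T}" "t \<in> {0..T}" for s t
      unfolding r_def 4 level
      by (subst pairing_vec_star_two_vertices) (simp_all add: st Z del: atLeastAtMost_iff)
    then show ?thesis
      by (intro exI[of _ 0]) simp
  qed
  then show "controlled_path \<alpha> T \<XX> Z"
    using Z(1) by (simp add: controlled_path_def r_def level forests_le_def)
qed

end
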